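(* Let $A\in\mathbb{C}^{n\times n}$ be a matrix having all its eigenvalues in the open right half-plane. Given any Hermitian positive definite $C\in\mathbb{C}^{n\times n}$, let $G\in\mathbb{C}^{n\times n}$ denote the solution of the Lyapunov equation $A^*G+GA=C$. Let $b\in\mathbb{C}^n$ be nonzero. Then, at the $k$th iteration, the residual $r_k$ produced by GMRES applied to $Ax=b$ with starting vector $x_0=0$ satisfies $$\frac{\|r_k\|_2}{\|b\|_2}\;\le\;\sqrt{\kappa_2(G)}\;\min_{\substack{p\in\mathcal{P}_k\\ p(0)=1}}\|p(A)\|_G,$$ where $\kappa_2(G):=\|G\|_2\,\|G^{-1}\|_2$.
   Context: $\|\cdot\|_2$ is the Euclidean vector norm and its induced matrix norm; $A^*$ is the conjugate transpose. $\mathcal{P}_k$ is the set of complex polynomials of degree $k$ or less. Since all eigenvalues of $A$ lie in the open right half-plane and $C$ is Hermitian positive definite, the equation $A^*G+GA=C$ has a unique solution $G$, and it is Hermitian positive definite (standard fact). The $G$-inner product is $\langle v,w\rangle_G:=w^*Gv$, with vector norm $\|v\|_G:=\sqrt{\langle v,v\rangle_G}$ and induced matrix norm $\|X\|_G:=\max_{v\ne 0}\|Xv\|_G/\|v\|_G$ for $X\in\mathbb{C}^{n\times n}$. GMRES (in the standard Euclidean norm, with $x_0=0$): at iteration $k$ it produces $x_k$ minimizing $\|b-Ax\|_2$ over all $x$ in the Krylov subspace $\mathcal{K}_k(A,b)=\mathrm{span}\{b,Ab,\ldots,A^{k-1}b\}$, and the residual is $r_k:=b-Ax_k$. Equivalently,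 $\|r_k\|_2=\min_{p\in\mathcal{P}_k,\,p(0)=1}\|p(A)b\|_2$. *)

theory Defs
  imports "HOL-Analysis.Analysis" "HOL-Computational_Algebra.Polynomial"
begin

definition eigenvalue :: "complex^'n^'n \<Rightarrow> complex \<Rightarrow> bool" where
  "eigenvalue A l \<longleftrightarrow> (\<exists>v. v \<noteq> 0 \<and> A *v v = l *s v)"

definition conj_transpose :: "complex^'n^'n \<Rightarrow> complex^'n^'n" where
  "conj_transpose A = map_matrix cnj (transpose A)"

definition hermitian :: "complex^'n^'n \<Rightarrow> bool" where
  "hermitian A \<longleftrightarrow> conj_transpose A = A"

text \<open>The form \<open>v\<^sup>* G w\<close>, conjugate-linear in its first argument.\<close>

definition ginner :: "complex^'n^'n \<Rightarrow> complex^'n \<Rightarrow> complex^'n \<Rightarrow> complex" where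
  "ginner G v w = (\<Sum>i\<in>UNIV. cnj (v $ i) * (G *v w) $ i)"

text \<open>For Hermitian \<open>A\<close> the number \<open>v\<^sup>* A v\<close> is real, so taking real parts below
  (and in \<open>gnorm\<close>) only changes the type.\<close>

definition hermitian_pos_def :: "complex^'n^'n \<Rightarrow> bool" where
  "hermitian_pos_def A \<longleftrightarrow> hermitian A \<and> (\<forall>v. v \<noteq> 0 \<longrightarrow> Re (ginner A v v) > 0)"

definition gnorm :: "complex^'n^'n \<Rightarrow> complex^'n \<Rightarrow> real" where
  "gnorm G v = sqrt (Re (ginner G v v))"

text \<open>The norm on \<open>complex^'n\<close> is the Euclidean one, and \<open>onorm\<close> is the operator norm it induces.
  For Hermitian positive definite \<open>G\<close> the supremum in \<open>gmat_norm\<close> is a maximum,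
  by compactness of the unit sphere.\<close>

definition gmat_norm :: "complex^'n^'n \<Rightarrow> complex^'n^'n \<Rightarrow> real" where
  "gmat_norm G X = (SUP v\<in>{v. v \<noteq> 0}. gnorm G (X *v v) / gnorm G v)"

definition mat_norm2 :: "complex^'n^'n \<Rightarrow> real" where
  "mat_norm2 X = onorm ((*v) X)"

definition cond2 :: "complex^'n^'n \<Rightarrow> real" where
  "cond2 X = mat_norm2 X * mat_norm2 (matrix_inv X)"

text \<open>Multiplication and \<open>^\<close> on the type of matrices are entrywise,
  so powers are iterated with \<open>**\<close>.\<close>

definition mat_power :: "complex^'n^'n \<Rightarrow> nat \<Rightarrow> complex^'n^'n" where
  "mat_power A i = (((**) A) ^^ i) (mat 1)"

definition poly_mat :: "complex poly \<Rightarrow> complex^'n^'n \<Rightarrow> complex^'n^'n" where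
  "poly_mat p A = (\<Sum>i\<le>degree p. mat (coeff p i) ** mat_power A i)"

text \<open>\<open>vec.span\<close> is the complex span; the unqualified \<open>span\<close> would be the real one.\<close>

definition krylov :: "complex^'n^'n \<Rightarrow> complex^'n \<Rightarrow> nat \<Rightarrow> (complex^'n) set" where
  "krylov A b k = vec.span {mat_power A i *v b | i. i < k}"

text \<open>\<open>x\<close> is a \<open>k\<close>-th iterate of GMRES for \<open>A x = b\<close> with starting vector \<open>0\<close>.\<close>

definition gmres_iterate ::
    "complex^'n^'n \<Rightarrow> complex^'n \<Rightarrow> nat \<Rightarrow> complex^'n \<Rightarrow> bool" where
  "gmres_iterate A b k x \<longleftrightarrow> is_arg_min (\<lambda>y. norm (b - A *v y)) (\<lambda>y. y \<in> krylov A b k) x"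

end

theory Submission
  imports Defs "HOL-Computational_Algebra.Fundamental_Theorem_Algebra"
begin

text \<open>
  Everything is compared through the energy norm \<open>gnorm G\<close>. For Hermitian positive definite
  \<open>G\<close> it is equivalent to the Euclidean norm, with \<open>gnorm G v \<le> sqrt \<parallel>G\<parallel> * norm v\<close> and
  \<open>norm v \<le> sqrt \<parallel>G\<^sup>-\<^sup>1\<parallel> * gnorm G v\<close>. For an admissible \<open>p\<close> the vector \<open>p(A) b\<close> is the
  residual of some element of the Krylov space, so
  \<open>norm r \<le> norm (p(A) b) \<le> sqrt \<parallel>G\<^sup>-\<^sup>1\<parallel> * gnorm G (p(A) b)\<close>; passing to the induced matrix
  norm and back to \<open>norm b\<close> costs the other factor \<open>sqrt \<parallel>G\<parallel>\<close>
  (\<open>gmres_residual_le_poly_mat\<close>, \<open>norm_le_cond2_gmat_norm\<close>).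

  What has to be shown first is that the solution \<open>G\<close> of the Lyapunov equation is Hermitian
  and positive definite. The Cayley transform \<open>B = (A - 1)(A + 1)\<^sup>-\<^sup>1\<close> maps the open right
  half-plane to the open unit disc, so \<open>B\<^sup>k v\<close> tends to 0 for every \<open>v\<close>, and it turns the
  Lyapunov equation into \<open>x \<bullet> G y - B x \<bullet> G (B y) = 2 (S x \<bullet> C (S y))\<close> with
  \<open>S = (A + 1)\<^sup>-\<^sup>1\<close> (\<open>lyapunov_cayley\<close>). Hence the antisymmetric part of the form \<open>x \<bullet> G y\<close>
  is invariant under \<open>B\<close> and vanishes in the limit, while for \<open>v \<noteq> 0\<close> the numbers
  \<open>B\<^sup>k v \<bullet> G (B\<^sup>k v)\<close> decrease to 0, strictly in the first step, which makes \<open>v \<bullet> G v\<close>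
  positive (\<open>lyapunov_symmetric\<close>, \<open>lyapunov_positive\<close>).

  The convergence \<open>B\<^sup>k v \<longlonglongrightarrow> 0\<close> is obtained without canonical forms: some nonzero
  polynomial in \<open>B\<close> annihilates \<open>v\<close>, and splitting off one linear factor at a time reduces the
  claim to a scalar recurrence (\<open>mat_power_tendsto_zero_if_annihilated\<close>).
\<close>

section \<open>The real inner product behind the sesquilinear form\<close>

lemma Re_ginner: "Re (ginner G v w) = v \<bullet> (G *v w)"
  by (simp add: ginner_def inner_vec_def inner_complex_def)

lemma gnorm_eq: "gnorm G v = sqrt (v \<bullet> (G *v v))"
  by (simp add: gnorm_def Re_ginner)

lemma inner_conj_transpose:
  fixes A :: "complex^'n^'n"
  shows "x \<bullet> (conj_transpose A *v y) = (A *v x) \<bullet> y"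
proof -
  have "x \<bullet> (conj_transpose A *v y) = (\<Sum>i\<in>UNIV. \<Sum>j\<in>UNIV. x $ i \<bullet> (cnj (A $ j $ i) * y $ j))"
    by (simp add: inner_vec_def conj_transpose_def matrix_vector_mult_def transpose_def
        map_matrix_def inner_sum_right)
  also have "\<dots> = (\<Sum>j\<in>UNIV. \<Sum>i\<in>UNIV. (A $ j $ i * x $ i) \<bullet> y $ j)"
    by (subst sum.swap) (simp add: inner_complex_def algebra_simps)
  also have "\<dots> = (A *v x) \<bullet> y"
    by (simp add: inner_vec_def matrix_vector_mult_def inner_sum_left)
  finally show ?thesis .
qed

lemma hermitian_inner_commute:
  assumes "hermitian C"
  shows "x \<bullet> (C *v y) = y \<bullet> (C *v x)"
  using inner_conj_transpose[of x C y] assms by (simp add: hermitian_def inner_commute)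

section \<open>Powers of a matrix with spectrum in the open unit disc\<close>

lemma mat_power_0 [simp]: "mat_power A 0 = mat 1"
  by (simp add: mat_power_def)

lemma mat_power_Suc: "mat_power A (Suc i) *v v = A *v (mat_power A i *v v)"
  by (simp add: mat_power_def matrix_vector_mul_assoc)

lemma mat_power_Suc2: "mat_power A (Suc i) *v v = mat_power A i *v (A *v v)"
  by (induction i) (simp_all add: mat_power_Suc)

lemma mat_mult_vector: "mat c *v (v :: complex^'n) = c *s v"
  by (simp add: vec_eq_iff matrix_vector_mult_def mat_def if_distrib[of "\<lambda>z. z * _"] cong: if_cong)

lemma matrix_vector_mult_sum_left: "(\<Sum>i\<in>I. X i) *v v = (\<Sum>i\<in>I. X i *v (v :: complex^'n))"
  by (induction I rule: infinite_finite_induct) (simp_all add: matrix_vector_mult_add_rdistrib)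

lemma poly_mat_vector:
  assumes "degree p \<le> N"
  shows "poly_mat p A *v v = (\<Sum>i\<le>N. coeff p i *s (mat_power A i *v v))"
proof -
  have "poly_mat p A *v v = (\<Sum>i\<le>degree p. coeff p i *s (mat_power A i *v v))"
    by (simp add: poly_mat_def matrix_vector_mult_sum_left mat_mult_vector
        flip: matrix_vector_mul_assoc)
  also have "\<dots> = (\<Sum>i\<le>N. coeff p i *s (mat_power A i *v v))"
    using assms by (intro sum.mono_neutral_left) (auto simp: coeff_eq_0)
  finally show ?thesis .
qed

lemma poly_mat_linear_factor:
  "poly_mat ([:- l, 1:] * q) A *v v = poly_mat q A *v (A *v v - l *s v)"
proof -
  let ?N = "degree q" and ?u = "\<lambda>i. mat_power A i *v v"
  have eq: "[:- l, 1:] * q = pCons 0 q - smult l q"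
    by simp
  have "degree ([:- l, 1:] * q) \<le> Suc ?N"
    unfolding eq by (intro degree_diff_le degree_pCons_le) (simp add: degree_smult_le le_SucI)
  then have "poly_mat ([:- l, 1:] * q) A *v v
      = (\<Sum>i\<le>Suc ?N. coeff (pCons 0 q) i *s ?u i) - (\<Sum>i\<le>Suc ?N. (l * coeff q i) *s ?u i)"
    unfolding eq by (simp add: poly_mat_vector vec.scale_left_diff_distrib sum_subtractf)
  also have "(\<Sum>i\<le>Suc ?N. coeff (pCons 0 q) i *s ?u i) = (\<Sum>i\<le>?N. coeff q i *s ?u (Suc i))"
    by (subst sum.atMost_Suc_shift) simp
  also have "(\<Sum>i\<le>Suc ?N. (l * coeff q i) *s ?u i) = (\<Sum>i\<le>?N. (l * coeff q i) *s ?u i)"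
    by (simp add: coeff_eq_0)
  also have "(\<Sum>i\<le>?N. coeff q i *s ?u (Suc i)) - (\<Sum>i\<le>?N. (l * coeff q i) *s ?u i)
      = poly_mat q A *v (A *v v - l *s v)"
    by (simp add: poly_mat_vector[OF order_refl] mat_power_Suc2 matrix_vector_mult_diff_distrib
        vector_scalar_commute vec.scale_right_diff_distrib vec.scale_sum_right sum_subtractf mult.commute)
  finally show ?thesis .
qed

lemma poly_mat_commute: "poly_mat q A *v (A *v v) = A *v (poly_mat q A *v v)"
  by (simp add: poly_mat_vector[OF order_refl] vec.sum vector_scalar_commute
      flip: mat_power_Suc2 mat_power_Suc)

text \<open>
  More than \<open>n\<close> vectors of the orbit \<open>v, B v, B\<^sup>2 v, \<dots>\<close> cannot be linearly independent.
  If the orbit repeats itself, the vectors do not form a set of the right cardinality, and the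
  polynomial is the difference of two monomials instead.
\<close>
lemma exists_annihilating_poly:
  fixes B :: "complex^'n^'n"
  obtains p where "p \<noteq> 0" "poly_mat p B *v v = 0"
proof -
  let ?N = "CARD('n)" and ?u = "\<lambda>i. mat_power B i *v v"
  have "\<exists>c. (\<exists>i\<le>?N. c i \<noteq> 0) \<and> (\<Sum>i\<le>?N. c i *s ?u i) = 0"
  proof (cases "inj_on ?u {..?N}")
    case True
    then have "card (?u ` {..?N}) = Suc ?N"
      by (simp add: card_image)
    then have "vec.dependent (?u ` {..?N})"
      using vec.independent_card_le_dim[of "?u ` {..?N}" UNIV]
      by (auto simp: vec.dim_UNIV vec_dim_card card_cart_basis)
    then obtain f w where f: "(\<Sum>w\<in>?u ` {..?N}. f w *s w) = 0" "w \<in> ?u ` {..?N}" "f w \<noteq> 0"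
      by (auto simp: vec.dependent_finite)
    then show ?thesis
      using True by (intro exI[of _ "f \<circ> ?u"]) (auto simp: sum.reindex)
  next
    case False
    then obtain i j where ij: "i \<le> ?N" "j \<le> ?N" "i \<noteq> j" "?u i = ?u j"
      by (auto simp: inj_on_def)
    define c :: "nat \<Rightarrow> complex" where "c m = of_bool (m = i) - of_bool (m = j)" for m
    have "(\<Sum>m\<le>?N. c m *s ?u m)
        = (\<Sum>m\<le>?N. if m = i then ?u m else 0) - (\<Sum>m\<le>?N. if m = j then ?u m else 0)"
      by (subst sum_subtractf[symmetric]) (auto intro!: sum.cong simp: c_def vec_eq_iff)
    also have "\<dots> = 0"
      using ij by simp
    finally show ?thesis
      using ij by (intro exI[of _ c]) (auto simp: c_def)
  qed
  then obtain c i where c: "i \<le> ?N" "c i \<noteq> 0" "(\<Sum>i\<le>?N. c i *s ?u i) = 0"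
    by auto
  define p where "p = (\<Sum>i\<le>?N. monom (c i) i)"
  have coeff: "coeff p m = (if m \<le> ?N then c m else 0)" for m
    by (simp add: p_def coeff_sum coeff_monom)
  have "degree p \<le> ?N"
    by (rule degree_le) (simp add: coeff)
  then have "poly_mat p B *v v = 0"
    using c(3) by (simp add: poly_mat_vector coeff)
  moreover have "p \<noteq> 0"
    using c(1,2) coeff[of i] by auto
  ultimately show thesis
    using that by blast
qed

text \<open>
  Once the perturbation has norm below \<open>(1 - norm l) d\<close>, the excess of \<open>norm (u m)\<close> over
  \<open>d\<close> shrinks at least by the factor \<open>norm l\<close> in each step.
\<close>
lemma contracting_recurrence_tendsto_zero:
  fixes u w :: "nat \<Rightarrow> complex^'n"
  assumes l: "norm l < 1"
    and w: "w \<longlonglongrightarrow> 0"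
    and rec: "\<And>m. u (Suc m) = l *s u m + w m"
  shows "u \<longlonglongrightarrow> 0"
proof (rule tendsto_norm_zero_cancel, rule LIMSEQ_I)
  fix e :: real
  assume "e > 0"
  define d where "d = e / 2"
  have "d > 0"
    using \<open>e > 0\<close> by (simp add: d_def)
  then have "d * (1 - norm l) > 0"
    using l by simp
  from LIMSEQ_D[OF w this] obtain N where N: "norm (w m) < d * (1 - norm l)" if "m \<ge> N" for m
    by auto
  have norm_smult: "norm (l *s x) = norm l * norm x" for x :: "complex^'n"
    by (simp add: norm_vec_def norm_mult L2_set_def power_mult_distrib sum_distrib_left[symmetric]
        real_sqrt_mult)
  have bound: "norm (u (N + m)) \<le> d + norm l ^ m * norm (u N)" for m
  proof (induction m)
    case (Suc m)
    have "norm (u (N + Suc m)) \<le> norm l * norm (u (N + m)) + norm (w (N + m))"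
      using rec[of "N + m"] norm_triangle_ineq[of "l *s u (N + m)" "w (N + m)"]
      by (simp add: norm_smult)
    also have "\<dots> \<le> norm l * (d + norm l ^ m * norm (u N)) + d * (1 - norm l)"
      using N[of "N + m"] Suc by (intro add_mono mult_left_mono) auto
    finally show ?case
      by (simp add: algebra_simps)
  qed (use \<open>d > 0\<close> in simp)
  have "(\<lambda>m. norm l ^ m * norm (u N)) \<longlonglongrightarrow> 0"
    using l by (intro tendsto_mult_left_zero LIMSEQ_realpow_zero) auto
  from LIMSEQ_D[OF this \<open>d > 0\<close>]
  obtain K where K: "norm l ^ m * norm (u N) < d" if "m \<ge> K" for m
    by auto
  have "norm (u m) < e" if "m \<ge> N + K" for m
  proof -
    have "norm l ^ (m - N) * norm (u N) < d"
      using that by (intro K) simp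
    then show ?thesis
      using bound[of "m - N"] that by (simp add: d_def)
  qed
  then show "\<exists>N. \<forall>m\<ge>N. norm (norm (u m) - 0) < e"
    by auto
qed

text \<open>
  Split a root \<open>l\<close> off the annihilating polynomial, leaving the cofactor \<open>q\<close>. The cofactor
  annihilates \<open>(B - l) v\<close>, and \<open>B\<^sup>k v\<close> satisfies a recurrence with multiplier \<open>l\<close> driven by
  \<open>B\<^sup>k (B - l) v\<close>. If \<open>l\<close> is not an eigenvalue, nothing is known about \<open>norm l\<close>,
  but then \<open>q\<close> already annihilates \<open>v\<close>.
\<close>
lemma mat_power_tendsto_zero_if_annihilated:
  fixes B :: "complex^'n^'n"
  assumes spec: "\<And>l. eigenvalue B l \<Longrightarrow> norm l < 1"
    and "p \<noteq> 0" "poly_mat p B *v v = 0"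
  shows "(\<lambda>k. mat_power B k *v v) \<longlonglongrightarrow> 0"
  using assms(2,3)
proof (induction "degree p" arbitrary: p v)
  case 0
  then obtain a where "p = [:a:]"
    using degree_eq_zeroE by metis
  then have "v = 0"
    using 0 by (simp add: poly_mat_vector[OF order_refl])
  then show ?case
    by simp
next
  case (Suc d)
  then have "\<not> constant (poly p)"
    by (simp add: constant_degree)
  then obtain l where "poly p l = 0"
    using fundamental_theorem_of_algebra by blast
  then obtain q where q: "p = [:- l, 1:] * q"
    by (auto simp: poly_eq_0_iff_dvd dvd_def)
  have "q \<noteq> 0"
    using Suc.prems(1) q by auto
  then have deg: "d = degree q"
    using Suc.hyps(2) by (simp add: q degree_mult_eq del: mult_pCons_left)
  define w where "w = B *v v - l *s v"
  have qw: "poly_mat q B *v w = 0"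
    using Suc.prems(2) unfolding q w_def poly_mat_linear_factor .
  show ?case
  proof (cases "eigenvalue B l")
    case True
    have "(\<lambda>k. mat_power B k *v w) \<longlonglongrightarrow> 0"
      by (rule Suc.hyps(1)[OF deg \<open>q \<noteq> 0\<close> qw])
    moreover have "mat_power B (Suc k) *v v = l *s (mat_power B k *v v) + mat_power B k *v w" for k
      by (simp add: w_def mat_power_Suc2 matrix_vector_mult_diff_distrib vector_scalar_commute)
    ultimately show ?thesis
      by (rule contracting_recurrence_tendsto_zero[OF spec[OF True]])
  next
    case False
    have "B *v (poly_mat q B *v v) = l *s (poly_mat q B *v v)"
      using qw
      by (simp add: w_def matrix_vector_mult_diff_distrib vector_scalar_commute poly_mat_commute)
    then have "poly_mat q B *v v = 0"
      using False by (auto simp: eigenvalue_def)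
    then show ?thesis
      by (rule Suc.hyps(1)[OF deg \<open>q \<noteq> 0\<close>])
  qed
qed

lemma mat_power_tendsto_zero:
  fixes B :: "complex^'n^'n"
  assumes "\<And>l. eigenvalue B l \<Longrightarrow> norm l < 1"
  shows "(\<lambda>k. mat_power B k *v v) \<longlonglongrightarrow> 0"
  using exists_annihilating_poly[of B v] mat_power_tendsto_zero_if_annihilated[OF assms] by metis

section \<open>The Cayley transform and the Lyapunov equation\<close>

lemma matrix_inv_right_vector:
  fixes M :: "complex^'n^'n"
  assumes "\<And>v. M *v v = 0 \<Longrightarrow> v = 0"
  shows "M *v (matrix_inv M *v x) = x"
proof -
  have "inj ((*v) M)"
    using assms by (auto simp: vec.inj_iff_eq_0)
  then have "invertible M"
    by (simp add: invertible_left_inverse matrix_left_invertible_injective)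
  then have "M ** matrix_inv M = mat 1"
    unfolding invertible_def matrix_inv_def by (rule someI2_ex) simp
  then show ?thesis
    by (simp add: matrix_vector_mul_assoc)
qed

definition cayley :: "complex^'n^'n \<Rightarrow> complex^'n^'n" where
  "cayley A = (A - mat 1) ** matrix_inv (A + mat 1)"

lemma cayley_vector: "cayley A *v x = A *v (matrix_inv (A + mat 1) *v x) - matrix_inv (A + mat 1) *v x"
  by (simp add: cayley_def matrix_vector_mult_diff_rdistrib flip: matrix_vector_mul_assoc)

lemma cayley_inverse_factor:
  fixes A :: "complex^'n^'n"
  assumes "\<And>l. eigenvalue A l \<Longrightarrow> Re l > 0"
  shows "A *v (matrix_inv (A + mat 1) *v x) + matrix_inv (A + mat 1) *v x = x"
proof -
  have inj: "v = 0" if "(A + mat 1) *v v = 0" for v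
  proof (rule ccontr)
    assume "v \<noteq> 0"
    have "A *v v = (- 1) *s v"
      using that by (simp add: matrix_vector_mult_add_rdistrib eq_neg_iff_add_eq_0)
    then have "eigenvalue A (- 1)"
      using \<open>v \<noteq> 0\<close> unfolding eigenvalue_def by blast
    then show False
      using assms by force
  qed
  show ?thesis
    using matrix_inv_right_vector[of "A + mat 1" x, OF inj]
    by (simp add: matrix_vector_mult_add_rdistrib)
qed

text \<open>
  An eigenvalue \<open>m\<close> of the transform comes from the eigenvalue \<open>l = (1 + m) / (1 - m)\<close> of
  \<open>A\<close>, and \<open>Re l\<close> has the sign of \<open>1 - (norm m)\<^sup>2\<close>.
\<close>
lemma cayley_eigenvalue:
  fixes A :: "complex^'n^'n"
  assumes spec: "\<And>l. eigenvalue A l \<Longrightarrow> Re l > 0"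
    and "eigenvalue (cayley A) m"
  shows "norm m < 1"
proof -
  obtain x where x: "x \<noteq> 0" "cayley A *v x = m *s x"
    using assms(2) by (auto simp: eigenvalue_def)
  define y where "y = matrix_inv (A + mat 1) *v x"
  have xy: "A *v y + y = x"
    unfolding y_def by (rule cayley_inverse_factor[OF spec])
  have "y \<noteq> 0"
    using xy x(1) by auto
  have eq: "A *v y - y = m *s (A *v y + y)"
    using x(2) unfolding cayley_vector xy by (simp add: y_def)
  have "m \<noteq> 1"
  proof
    assume "m = 1"
    then have "2 *s y = 0"
      using eq by (simp add: vec_eq_iff algebra_simps)
    then show False
      using \<open>y \<noteq> 0\<close> by simp
  qed
  have "A *v y = ((1 + m) / (1 - m)) *s y"
  proof (rule vec_eq_iff[THEN iffD2], rule allI)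
    fix i
    have "(A *v y) $ i - y $ i = m * ((A *v y) $ i + y $ i)"
      using arg_cong[OF eq, of "\<lambda>z. z $ i"] by (simp add: distrib_left)
    then show "(A *v y) $ i = (((1 + m) / (1 - m)) *s y) $ i"
      using \<open>m \<noteq> 1\<close> by (simp add: field_simps)
  qed
  then have "Re ((1 + m) / (1 - m)) > 0"
    using \<open>y \<noteq> 0\<close> spec unfolding eigenvalue_def by blast
  moreover have "Re ((1 + m) / (1 - m)) = (1 - (norm m)\<^sup>2) / (norm (1 - m))\<^sup>2"
    unfolding cmod_power2 Re_divide by (simp add: algebra_simps power2_eq_square)
  ultimately have "(norm m)\<^sup>2 < 1"
    using \<open>m \<noteq> 1\<close> by (simp add: zero_less_divide_iff)
  then show ?thesis
    by (simp add: abs_square_less_1)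
qed

text \<open>
  With \<open>x = (A + 1) x'\<close> and \<open>y = (A + 1) y'\<close> the left-hand side is the difference of the
  form at \<open>(A + 1) x', (A + 1) y'\<close> and at \<open>(A - 1) x', (A - 1) y'\<close>; only the mixed terms
  \<open>A x' \<bullet> G y'\<close> and \<open>x' \<bullet> G A y'\<close> survive, each twice.
\<close>
lemma lyapunov_cayley:
  fixes A C G :: "complex^'n^'n"
  assumes spec: "\<And>l. eigenvalue A l \<Longrightarrow> Re l > 0"
    and lyap: "conj_transpose A ** G + G ** A = C"
  shows "x \<bullet> (G *v y) - (cayley A *v x) \<bullet> (G *v (cayley A *v y))
    = 2 * ((matrix_inv (A + mat 1) *v x) \<bullet> (C *v (matrix_inv (A + mat 1) *v y)))"
proof -
  define x' where "x' = matrix_inv (A + mat 1) *v x"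
  define y' where "y' = matrix_inv (A + mat 1) *v y"
  have x: "A *v x' + x' = x" and y: "A *v y' + y' = y"
    unfolding x'_def y'_def by (rule cayley_inverse_factor[OF spec], assumption)+
  have "x' \<bullet> (C *v y') = (A *v x') \<bullet> (G *v y') + x' \<bullet> (G *v (A *v y'))"
    unfolding lyap[symmetric]
    by (simp add: matrix_vector_mult_add_rdistrib inner_add_right inner_conj_transpose
        flip: matrix_vector_mul_assoc)
  then show ?thesis
    unfolding cayley_vector x'_def[symmetric] y'_def[symmetric] unfolding x[symmetric] y[symmetric]
    by (simp add: matrix_vector_right_distrib matrix_vector_mult_diff_distrib inner_add_left
        inner_add_right inner_diff_left inner_diff_right)
qed

lemma cayley_form_tendsto_zero:
  fixes A G :: "complex^'n^'n"
  assumes "\<And>l. eigenvalue A l \<Longrightarrow> Re l > 0"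
  shows "(\<lambda>k. (mat_power (cayley A) k *v x) \<bullet> (G *v (mat_power (cayley A) k *v y))) \<longlonglongrightarrow> 0"
proof -
  have lim: "(\<lambda>k. mat_power (cayley A) k *v v) \<longlonglongrightarrow> 0" for v
    by (rule mat_power_tendsto_zero) (rule cayley_eigenvalue[OF assms])
  have "(\<lambda>k. G *v (mat_power (cayley A) k *v y)) \<longlonglongrightarrow> 0"
    using bounded_linear.tendsto[OF matrix_vector_mul_bounded_linear lim] by fastforce
  from tendsto_inner[OF lim this] show ?thesis
    by simp
qed

lemma lyapunov_symmetric:
  fixes A C G :: "complex^'n^'n"
  assumes spec: "\<And>l. eigenvalue A l \<Longrightarrow> Re l > 0"
    and herm: "hermitian C"
    and lyap: "conj_transpose A ** G + G ** A = C"
  shows "x \<bullet> (G *v y) = y \<bullet> (G *v x)"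
proof -
  define h where "h x y = x \<bullet> (G *v y) - y \<bullet> (G *v x)" for x y
  have step: "h (cayley A *v x) (cayley A *v y) = h x y" for x y
    using lyapunov_cayley[OF spec lyap, of x y] lyapunov_cayley[OF spec lyap, of y x]
      hermitian_inner_commute[OF herm]
    unfolding h_def by (smt (verit))
  let ?P = "\<lambda>k. mat_power (cayley A) k"
  have "h (?P k *v x) (?P k *v y) = h x y" for k
    by (induction k) (simp_all add: mat_power_Suc step)
  moreover have "(\<lambda>k. h (?P k *v x) (?P k *v y)) \<longlonglongrightarrow> 0 - 0"
    unfolding h_def by (intro tendsto_diff cayley_form_tendsto_zero[OF spec])
  ultimately have "h x y = 0"
    by (simp add: LIMSEQ_const_iff)
  then show ?thesis
    by (simp add: h_def)
qed

lemma lyapunov_positive: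
  fixes A C G :: "complex^'n^'n"
  assumes spec: "\<And>l. eigenvalue A l \<Longrightarrow> Re l > 0"
    and pos: "\<And>v. v \<noteq> 0 \<Longrightarrow> v \<bullet> (C *v v) > 0"
    and lyap: "conj_transpose A ** G + G ** A = C"
    and "v \<noteq> 0"
  shows "v \<bullet> (G *v v) > 0"
proof -
  define s where "s k = (mat_power (cayley A) k *v v) \<bullet> (G *v (mat_power (cayley A) k *v v))" for k
  have "v \<bullet> (C *v v) \<ge> 0" for v
    using pos[of v] by (cases "v = 0") auto
  then have "s (Suc k) \<le> s k" for k
    using lyapunov_cayley[OF spec lyap, of "mat_power (cayley A) k *v v" "mat_power (cayley A) k *v v"]
    by (simp add: s_def mat_power_Suc) (smt (verit))
  then have "decseq s"
    by (rule decseq_SucI)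
  then have "s 1 \<ge> 0"
    by (rule decseq_ge) (unfold s_def, rule cayley_form_tendsto_zero[OF spec])
  moreover have "matrix_inv (A + mat 1) *v v \<noteq> 0"
    using cayley_inverse_factor[of A v, OF spec] \<open>v \<noteq> 0\<close> by auto
  then have "s 1 < s 0"
    using lyapunov_cayley[OF spec lyap, of v v] pos[of "matrix_inv (A + mat 1) *v v"]
    by (simp add: s_def mat_power_Suc)
  ultimately show ?thesis
    by (simp add: s_def)
qed

section \<open>Equivalence of the energy norm and the Euclidean norm\<close>

lemma norm_mult_le_mat_norm2: "norm (X *v v) \<le> mat_norm2 X * norm v"
  unfolding mat_norm2_def by (rule onorm[OF matrix_vector_mul_bounded_linear])

lemma mat_norm2_nonneg: "mat_norm2 X \<ge> 0"
  unfolding mat_norm2_def by (rule onorm_pos_le[OF matrix_vector_mul_bounded_linear])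

lemma gnorm_le_norm: "gnorm G v \<le> sqrt (mat_norm2 G) * norm v"
proof -
  have "v \<bullet> (G *v v) \<le> norm v * norm (G *v v)"
    by (rule norm_cauchy_schwarz)
  also have "\<dots> \<le> norm v * (mat_norm2 G * norm v)"
    by (intro mult_left_mono norm_mult_le_mat_norm2) simp
  finally have "v \<bullet> (G *v v) \<le> mat_norm2 G * (norm v)\<^sup>2"
    by (simp add: power2_eq_square ac_simps)
  then have "sqrt (v \<bullet> (G *v v)) \<le> sqrt (mat_norm2 G * (norm v)\<^sup>2)"
    by (rule real_sqrt_le_mono)
  then show ?thesis
    by (simp add: gnorm_eq real_sqrt_mult)
qed

text \<open>
  Symmetry for the real inner product is the same as being Hermitian: replacing \<open>y\<close> by
  \<open>\<i> *s y\<close> recovers the imaginary part of the sesquilinear form from its real part. The real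
  version makes the Cauchy-Schwarz argument below a matter of one real parameter.
\<close>

locale energy_matrix =
  fixes G :: "complex^'n^'n"
  assumes symmetric: "x \<bullet> (G *v y) = y \<bullet> (G *v x)"
    and positive: "v \<noteq> 0 \<Longrightarrow> v \<bullet> (G *v v) > 0"
begin

lemma gnorm_pos: "v \<noteq> 0 \<Longrightarrow> gnorm G v > 0"
  by (simp add: gnorm_eq positive)

lemma gnorm_0 [simp]: "gnorm G 0 = 0"
  by (simp add: gnorm_eq)

lemma gnorm_square: "(gnorm G v)\<^sup>2 = v \<bullet> (G *v v)"
  using positive[of v] by (cases "v = 0") (simp_all add: gnorm_eq)

lemma gnorm_cauchy_schwarz: "x \<bullet> (G *v y) \<le> gnorm G x * gnorm G y"
proof (cases "y = 0")
  case False
  define a where "a = y \<bullet> (G *v y)"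
  define c where "c = x \<bullet> (G *v y)"
  have "a > 0"
    unfolding a_def by (rule positive[OF False])
  define t where "t = c / a"
  have "0 \<le> (gnorm G (x - t *\<^sub>R y))\<^sup>2"
    by simp
  also have "\<dots> = x \<bullet> (G *v x) - 2 * t * c + t\<^sup>2 * a"
    unfolding gnorm_square
    by (simp add: a_def c_def matrix_vector_mult_diff_distrib
        linear_cmul[OF matrix_vector_mul_linear]
        inner_diff_left inner_diff_right symmetric[of y x] power2_eq_square algebra_simps)
  also have "\<dots> = x \<bullet> (G *v x) - c\<^sup>2 / a"
    using \<open>a > 0\<close> by (simp add: t_def power2_eq_square)
  finally have "c\<^sup>2 \<le> (x \<bullet> (G *v x)) * a"
    using \<open>a > 0\<close> by (simp add: field_simps)
  then have "c \<le> sqrt ((x \<bullet> (G *v x)) * a)"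
    by (rule real_le_rsqrt)
  then show ?thesis
    by (simp add: c_def a_def gnorm_eq real_sqrt_mult)
qed simp

text \<open>
  For \<open>u = G\<^sup>-\<^sup>1 v\<close> one has \<open>(norm v)\<^sup>2 = v \<bullet> G u\<close>, to which the Cauchy-Schwarz inequality for
  the energy form applies; its square norm at \<open>u\<close> is \<open>u \<bullet> v\<close>, controlled by \<open>\<parallel>G\<^sup>-\<^sup>1\<parallel>\<close>. This
  avoids the spectral theorem.
\<close>
lemma norm_le_gnorm: "norm v \<le> sqrt (mat_norm2 (matrix_inv G)) * gnorm G v"
proof (cases "v = 0")
  case False
  define K where "K = mat_norm2 (matrix_inv G)"
  define u where "u = matrix_inv G *v v"
  have "G *v u = v"
    unfolding u_def by (rule matrix_inv_right_vector) (use positive in force)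
  have "u \<bullet> v \<le> norm u * norm v"
    by (rule norm_cauchy_schwarz)
  also have "\<dots> \<le> (K * norm v) * norm v"
    unfolding u_def K_def by (intro mult_right_mono norm_mult_le_mat_norm2) simp
  finally have "u \<bullet> v \<le> K * (norm v)\<^sup>2"
    by (simp add: power2_eq_square)
  then have "sqrt (u \<bullet> v) \<le> sqrt (K * (norm v)\<^sup>2)"
    by (rule real_sqrt_le_mono)
  then have u: "gnorm G u \<le> sqrt K * norm v"
    using \<open>G *v u = v\<close> by (simp add: gnorm_eq real_sqrt_mult)
  have "(norm v)\<^sup>2 = v \<bullet> (G *v u)"
    using \<open>G *v u = v\<close> by (simp add: power2_norm_eq_inner)
  also have "\<dots> \<le> gnorm G v * gnorm G u"
    by (rule gnorm_cauchy_schwarz)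
  also have "\<dots> \<le> gnorm G v * (sqrt K * norm v)"
    using gnorm_pos[OF False] by (intro mult_left_mono u) simp
  finally have "norm v * norm v \<le> (sqrt K * gnorm G v) * norm v"
    by (simp add: power2_eq_square ac_simps)
  then show ?thesis
    using False unfolding K_def by simp
qed simp

text \<open>
  The supremum defining \<open>gmat_norm\<close> says nothing unless the quotients are bounded; they are,
  since both norms are equivalent to the Euclidean one.
\<close>
lemma gnorm_mult_le_gmat_norm: "gnorm G (X *v v) \<le> gmat_norm G X * gnorm G v"
proof (cases "v = 0")
  case False
  define K where "K = sqrt (mat_norm2 G) * (mat_norm2 X * sqrt (mat_norm2 (matrix_inv G)))"
  have "gnorm G (X *v w) / gnorm G w \<le> K" if "w \<noteq> 0" for w
  proof -
    have "gnorm G (X *v w) \<le> sqrt (mat_norm2 G) * norm (X *v w)"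
      by (rule gnorm_le_norm)
    also have "\<dots> \<le> sqrt (mat_norm2 G) * (mat_norm2 X * norm w)"
      by (intro mult_left_mono norm_mult_le_mat_norm2) (simp add: mat_norm2_nonneg)
    also have "\<dots> \<le> sqrt (mat_norm2 G)
        * (mat_norm2 X * (sqrt (mat_norm2 (matrix_inv G)) * gnorm G w))"
      by (intro mult_left_mono norm_le_gnorm) (simp_all add: mat_norm2_nonneg)
    also have "\<dots> = K * gnorm G w"
      by (simp add: K_def)
    finally show ?thesis
      using gnorm_pos[OF that] by (simp add: pos_divide_le_eq)
  qed
  then have "bdd_above ((\<lambda>w. gnorm G (X *v w) / gnorm G w) ` {w. w \<noteq> 0})"
    by (auto intro!: bdd_aboveI[of _ K])
  then have "gnorm G (X *v v) / gnorm G v \<le> gmat_norm G X"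
    unfolding gmat_norm_def using False by (intro cSUP_upper) auto
  then show ?thesis
    using gnorm_pos[OF False] by (simp add: pos_divide_le_eq)
qed simp

lemma gmat_norm_nonneg: "gmat_norm G X \<ge> 0"
proof -
  obtain v :: "complex^'n" where "v \<noteq> 0"
    by (metis axis_eq_0_iff zero_neq_one)
  then have "0 \<le> gmat_norm G X * gnorm G v"
    using gnorm_mult_le_gmat_norm[of X v] gnorm_pos[of "X *v v"] by (cases "X *v v = 0") auto
  then show ?thesis
    using gnorm_pos[OF \<open>v \<noteq> 0\<close>] by (simp add: zero_le_mult_iff)
qed

lemma norm_le_cond2_gmat_norm: "norm (X *v v) \<le> sqrt (cond2 G) * gmat_norm G X * norm v"
proof -
  let ?K = "mat_norm2 (matrix_inv G)"
  have "norm (X *v v) \<le> sqrt ?K * gnorm G (X *v v)"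
    by (rule norm_le_gnorm)
  also have "\<dots> \<le> sqrt ?K * (gmat_norm G X * gnorm G v)"
    by (intro mult_left_mono gnorm_mult_le_gmat_norm) (simp add: mat_norm2_nonneg)
  also have "\<dots> \<le> sqrt ?K * (gmat_norm G X * (sqrt (mat_norm2 G) * norm v))"
    by (intro mult_left_mono gnorm_le_norm gmat_norm_nonneg) (simp add: mat_norm2_nonneg)
  finally show ?thesis
    by (simp add: cond2_def real_sqrt_mult ac_simps)
qed

end

section \<open>The residual bound\<close>

text \<open>
  Since \<open>p(0) = 1\<close>, the vector \<open>p(A) b\<close> equals \<open>b - A y\<close> where \<open>y\<close> has the coordinates
  \<open>- coeff p (i + 1)\<close> along \<open>A\<^sup>i b\<close>, so it competes in the minimization.
\<close>
lemma gmres_residual_le_poly_mat: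
  assumes gmres: "gmres_iterate A b k x" and p: "degree p \<le> k" "poly p 0 = 1"
  shows "norm (b - A *v x) \<le> norm (poly_mat p A *v b)"
proof -
  define y where "y = (\<Sum>i<k. (- coeff p (Suc i)) *s (mat_power A i *v b))"
  have "y \<in> krylov A b k"
    unfolding krylov_def y_def by (intro vec.span_sum vec.span_scale vec.span_base) auto
  have "coeff p 0 = 1"
    using p(2) by (simp add: poly_0_coeff_0)
  have "poly_mat p A *v b = (\<Sum>i<Suc k. coeff p i *s (mat_power A i *v b))"
    using poly_mat_vector[OF p(1)] by (simp add: lessThan_Suc_atMost)
  also have "\<dots> = b + (\<Sum>i<k. coeff p (Suc i) *s (A *v (mat_power A i *v b)))"
    by (subst sum.lessThan_Suc_shift) (simp add: \<open>coeff p 0 = 1\<close> mat_power_Suc)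
  also have "\<dots> = b - A *v y"
    by (simp add: y_def vec.sum vector_scalar_commute sum_negf vec.neg)
  finally show ?thesis
    using gmres \<open>y \<in> krylov A b k\<close> by (auto simp: gmres_iterate_def is_arg_min_linorder)
qed

theorem theorem1:
  fixes A C G :: "complex^'n^'n" and b x r :: "complex^'n" and k :: nat
  assumes "\<And>l. eigenvalue A l \<Longrightarrow> Re l > 0"
    and "hermitian_pos_def C"
    and "conj_transpose A ** G + G ** A = C"
    and "b \<noteq> 0"
    and "gmres_iterate A b k x"
    and "r = b - A *v x"
  shows "norm r / norm b
    \<le> sqrt (cond2 G) * (INF p\<in>{p :: complex poly. degree p \<le> k \<and> poly p 0 = 1}. gmat_norm G (poly_mat p A))"
proof -
  have C: "hermitian C" "\<And>v. v \<noteq> 0 \<Longrightarrow> v \<bullet> (C *v v) > 0"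
    using assms(2) by (auto simp: hermitian_pos_def_def Re_ginner)
  interpret energy_matrix G
    by unfold_locales
      (rule lyapunov_symmetric[OF assms(1) C(1) assms(3)] lyapunov_positive[OF assms(1) C(2) assms(3)];
       assumption)+
  let ?S = "{p :: complex poly. degree p \<le> k \<and> poly p 0 = 1}"
  have bound: "norm r / norm b \<le> sqrt (cond2 G) * gmat_norm G (poly_mat p A)" if "p \<in> ?S" for p
  proof -
    have "norm r \<le> norm (poly_mat p A *v b)"
      using gmres_residual_le_poly_mat[OF assms(5)] that assms(6) by simp
    also have "\<dots> \<le> sqrt (cond2 G) * gmat_norm G (poly_mat p A) * norm b"
      by (rule norm_le_cond2_gmat_norm)
    finally show ?thesis
      using \<open>b \<noteq> 0\<close> by (simp add: pos_divide_le_eq)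
  qed
  have "1 \<in> ?S"
    by simp
  have "b = mat 1 *v b"
    by simp
  then have "norm b \<le> sqrt (cond2 G) * gmat_norm G (mat 1) * norm b"
    using norm_le_cond2_gmat_norm[of "mat 1" b] by simp
  then have "sqrt (cond2 G) \<noteq> 0"
    using \<open>b \<noteq> 0\<close> by auto
  moreover have "sqrt (cond2 G) \<ge> 0"
    by (simp add: cond2_def mat_norm2_nonneg)
  ultimately have pos: "sqrt (cond2 G) > 0"
    by linarith
  have "norm r / norm b / sqrt (cond2 G) \<le> (INF p\<in>?S. gmat_norm G (poly_mat p A))"
  proof (rule cINF_greatest)
    show "?S \<noteq> {}"
      using \<open>1 \<in> ?S\<close> by blast
    show "norm r / norm b / sqrt (cond2 G) \<le> gmat_norm G (poly_mat p A)" if "p \<in> ?S" for p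
      using bound[OF that] by (subst pos_divide_le_eq[OF pos]) (simp only: mult.commute)
  qed
  then show ?thesis
    by (subst (asm) pos_divide_le_eq[OF pos]) (simp only: mult.commute)
qed

end
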